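(* Let $G$ be an extraspecial, almost extraspecial or generalized extraspecial $2$-group. Let $n\geq 1$ and $k\geq 0$ be integers. (i) If $G\cong D_8^{\circ n}$, then $n_2(G)=4^n+2^n-1$, $n_4(G)=4^n-2^n$ and $\psi(G)=6\cdot 2^{2n}-2\cdot 2^n-1$. (ii) If $G\cong D_8^{\circ (n-1)}\circ Q_8$, then $n_2(G)=4^n-2^n-1$, $n_4(G)=4^n+2^n$ and $\psi(G)=6\cdot 2^{2n}+2\cdot 2^n-1$. (iii) If $G\cong D_8^{\circ n}\circ C_4$, then $n_2(G)=2^{2n+1}-1$, $n_4(G)=2^{2n+1}$ and $\psi(G)=12\cdot 2^{2n}-1$. (iv) If $G\cong D_8^{\circ n}\times C_2^k$, then $n_2(G)=2^{2n+k}+2^{n+k}-1$, $n_4(G)=2^{2n+k}-2^{n+k}$ and $\psi(G)=6\cdot 2^{2n+k}-2\cdot 2^{n+k}-1$. (v) If $G\cong (D_8^{\circ (n-1)}\circ Q_8)\times C_2^k$, then $n_2(G)=2^{2n+k}-2^{n+k}-1$, $n_4(G)=2^{2n+k}+2^{n+k}$ and $\psi(G)=6\cdot 2^{2n+k}+2\cdot 2^{n+k}-1$. (vi) If $G\cong (D_8^{\circ n}\circ C_4)\times C_2^k$, then $n_2(G)=2^{2n+k+1}-1$, $n_4(G)=2^{2n+k+1}$ and $\psi(G)=12\cdot 2^{2n+k}-1$.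
   Context: For a prime $p$, a finite $p$-group $G$ is called special if either $G$ is elementary abelian, or $G$ is of nilpotency class $2$ and $G'=Z(G)=\Phi(G)$ is elementary abelian; extraspecial if $G$ is special and $|G'|=p$; almost extraspecial if $G'=\Phi(G)$, $|G'|=p$ and $Z(G)\cong C_{p^2}$; generalized extraspecial if $G'=\Phi(G)$, $|G'|=p$ and $G'\leq Z(G)$. Here $G'$, $Z(G)$, $\Phi(G)$ are the derived subgroup, center and Frattini subgroup. $C_m$ is the cyclic group of order $m$, $C_2^k$ is the direct product of $k$ copies of $C_2$, $D_8$ is the dihedral group with $8$ elements and $Q_8$ is the quaternion group of order $8$. $G\circ H$ denotes the central product of $G$ and $H$: for the groups occurring here (each nontrivial factor has a cyclic center), it is the quotient of $G\times H$ obtained by identifying the unique subgroup of order $2$ of $Z(G)$ with the unique subgroup of order $2$ of $Z(H)$; a central product with the trivial group is the other factor. $G^{\circ n}$ is the central product of $n$ copies of $G$, with $G^{\circ 0}=\{1\}$ and $G^{\circ 1}=G$. For a finite group $G$, $n_m(G)$ is the number of elements of order $m$ in $G$, and $\psi(G)=\sum_{x\in G}o(x)$, where $o(x)$ is the order of $x$. *)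

theory Defs
  imports "HOL-Algebra.Algebra"
begin

section \<open>Characteristic subgroups and nilpotency class\<close>

definition center :: "('a, 'b) monoid_scheme \<Rightarrow> 'a set" where
  "center G = {z \<in> carrier G. \<forall>x \<in> carrier G. z \<otimes>\<^bsub>G\<^esub> x = x \<otimes>\<^bsub>G\<^esub> z}"

definition maximal_subgroup :: "'a set \<Rightarrow> ('a, 'b) monoid_scheme \<Rightarrow> bool" where
  "maximal_subgroup M G \<longleftrightarrow>
     subgroup M G \<and> M \<noteq> carrier G \<and>
     (\<forall>H. subgroup H G \<and> M \<subseteq> H \<longrightarrow> H = M \<or> H = carrier G)"

text \<open>The intersection with the carrier gives \<open>\<Phi>(G) = G\<close> if there are no maximal subgroups.\<close>

definition frattini :: "('a, 'b) monoid_scheme \<Rightarrow> 'a set" where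
  "frattini G = carrier G \<inter> \<Inter> {M. maximal_subgroup M G}"

text \<open>The derived subgroup is the library's \<^term>\<open>derived G (carrier G)\<close>; it is
  \<open>lower_central G 1\<close>, since the lower central series is indexed from 0 here.\<close>

primrec lower_central :: "('a, 'b) monoid_scheme \<Rightarrow> nat \<Rightarrow> 'a set" where
  "lower_central G 0 = carrier G"
| "lower_central G (Suc i) =
     generate G (\<Union>h \<in> lower_central G i. \<Union>x \<in> carrier G.
       {h \<otimes>\<^bsub>G\<^esub> x \<otimes>\<^bsub>G\<^esub> inv\<^bsub>G\<^esub> h \<otimes>\<^bsub>G\<^esub> inv\<^bsub>G\<^esub> x})"

definition has_nilpotency_class :: "('a, 'b) monoid_scheme \<Rightarrow> nat \<Rightarrow> bool" where
  "has_nilpotency_class G c \<longleftrightarrow>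
     lower_central G c = {\<one>\<^bsub>G\<^esub>} \<and> (\<forall>i < c. lower_central G i \<noteq> {\<one>\<^bsub>G\<^esub>})"


section \<open>Special, extraspecial and related \<open>p\<close>-groups\<close>

definition finite_p_group :: "nat \<Rightarrow> ('a, 'b) monoid_scheme \<Rightarrow> bool" where
  "finite_p_group p G \<longleftrightarrow>
     Factorial_Ring.prime p \<and> group G \<and> finite (carrier G) \<and> (\<exists>m. order G = p ^ m)"

definition elementary_abelian :: "nat \<Rightarrow> ('a, 'b) monoid_scheme \<Rightarrow> bool" where
  "elementary_abelian p G \<longleftrightarrow>
     comm_group G \<and> (\<forall>x \<in> carrier G. x [^]\<^bsub>G\<^esub> p = \<one>\<^bsub>G\<^esub>)"

definition special :: "nat \<Rightarrow> ('a, 'b) monoid_scheme \<Rightarrow> bool" where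
  "special p G \<longleftrightarrow> finite_p_group p G \<and>
     (elementary_abelian p G \<or>
      has_nilpotency_class G 2 \<and>
      derived G (carrier G) = center G \<and> center G = frattini G \<and>
      elementary_abelian p (G\<lparr>carrier := center G\<rparr>))"

definition extraspecial :: "nat \<Rightarrow> ('a, 'b) monoid_scheme \<Rightarrow> bool" where
  "extraspecial p G \<longleftrightarrow> special p G \<and> card (derived G (carrier G)) = p"

definition almost_extraspecial :: "nat \<Rightarrow> ('a, 'b) monoid_scheme \<Rightarrow> bool" where
  "almost_extraspecial p G \<longleftrightarrow> finite_p_group p G \<and>
     derived G (carrier G) = frattini G \<and> card (derived G (carrier G)) = p \<and>
     G\<lparr>carrier := center G\<rparr> \<cong> integer_mod_group (p ^ 2)"

definition generalized_extraspecial :: "nat \<Rightarrow> ('a, 'b) monoid_scheme \<Rightarrow> bool" where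
  "generalized_extraspecial p G \<longleftrightarrow> finite_p_group p G \<and>
     derived G (carrier G) = frattini G \<and> card (derived G (carrier G)) = p \<and>
     derived G (carrier G) \<subseteq> center G"


section \<open>Element orders\<close>

definition num_of_order :: "nat \<Rightarrow> ('a, 'b) monoid_scheme \<Rightarrow> nat" where
  "num_of_order m G = card {x \<in> carrier G. group.ord G x = m}"

definition sum_of_orders :: "('a, 'b) monoid_scheme \<Rightarrow> nat" where
  "sum_of_orders G = (\<Sum>x \<in> carrier G. group.ord G x)"


section \<open>The groups \<open>D\<^sub>8\<close>, \<open>Q\<^sub>8\<close> and \<open>C\<^sub>2\<^sup>k\<close>\<close>

text \<open>The dihedral group of order \<open>2 * m\<close>: the pair \<open>(i, e)\<close> stands for \<open>r\<^sup>i s\<^sup>e\<close>, where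
  \<open>r\<close> has order \<open>m\<close>, \<open>s\<close> has order 2 and \<open>s r = r\<^sup>-\<^sup>1 s\<close>.\<close>

definition dihedral :: "nat \<Rightarrow> (int \<times> bool) monoid" where
  "dihedral m =
     \<lparr>carrier = {0..<int m} \<times> UNIV,
      monoid.mult = (\<lambda>(i, e) (j, f). ((if e then i - j else i + j) mod int m, e \<noteq> f)),
      one = (0, False)\<rparr>"

abbreviation D8 :: "(int \<times> bool) monoid" where
  "D8 \<equiv> dihedral 4"

text \<open>The units \<open>\<plusminus>1, \<plusminus>i, \<plusminus>j, \<plusminus>k\<close> with Hamilton's multiplication; \<open>(a, b, c, d)\<close> stands for
  the quaternion \<open>a + b i + c j + d k\<close>.\<close>

definition Q8 :: "(int \<times> int \<times> int \<times> int) monoid" where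
  "Q8 =
     \<lparr>carrier = {(1, 0, 0, 0), (-1, 0, 0, 0), (0, 1, 0, 0), (0, -1, 0, 0),
                 (0, 0, 1, 0), (0, 0, -1, 0), (0, 0, 0, 1), (0, 0, 0, -1)},
      monoid.mult = (\<lambda>(a, b, c, d) (a', b', c', d').
        (a * a' - b * b' - c * c' - d * d',
         a * b' + b * a' + c * d' - d * c',
         a * c' - b * d' + c * a' + d * b',
         a * d' + b * c' - c * b' + d * a')),
      one = (1, 0, 0, 0)\<rparr>"

abbreviation C2_power :: "nat \<Rightarrow> (nat \<Rightarrow> int) monoid" where
  "C2_power k \<equiv> product_group {..<k} (\<lambda>_. integer_mod_group 2)"

lemma group_dihedral:
  assumes "m > 0"
  shows "group (dihedral m)"
proof (rule groupI)
  fix x assume "x \<in> carrier (dihedral m)"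
  then obtain i e where x: "x = (i, e)" "0 \<le> i" "i < int m"
    by (auto simp: dihedral_def)
  then show "\<exists>y \<in> carrier (dihedral m). y \<otimes>\<^bsub>dihedral m\<^esub> x = \<one>\<^bsub>dihedral m\<^esub>"
    using assms
    by (intro bexI[of _ "(if e then i else (- i) mod int m, e)"])
       (auto simp: dihedral_def mod_simps)
qed (use assms in \<open>auto simp: dihedral_def mod_simps algebra_simps\<close>)

lemma group_Q8: "group Q8"
proof (rule groupI)
  fix x assume x: "x \<in> carrier Q8"
  obtain a b c d where "x = (a, b, c, d)" by (metis prod.exhaust)
  with x show "\<exists>y \<in> carrier Q8. y \<otimes>\<^bsub>Q8\<^esub> x = \<one>\<^bsub>Q8\<^esub>"
    by (intro bexI[of _ "(a, - b, - c, - d)"]) (auto simp: Q8_def)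
next
  fix x y assume "x \<in> carrier Q8" "y \<in> carrier Q8"
  then show "x \<otimes>\<^bsub>Q8\<^esub> y \<in> carrier Q8"
    unfolding Q8_def by (simp, elim disjE) simp_all
next
  fix x y z :: "int \<times> int \<times> int \<times> int"
  show "x \<otimes>\<^bsub>Q8\<^esub> y \<otimes>\<^bsub>Q8\<^esub> z = x \<otimes>\<^bsub>Q8\<^esub> (y \<otimes>\<^bsub>Q8\<^esub> z)"
    by (cases x; cases y; cases z) (simp add: Q8_def algebra_simps)
qed (auto simp: Q8_def)


section \<open>Central products\<close>

definition central_involutions :: "('a, 'b) monoid_scheme \<Rightarrow> 'a set" where
  "central_involutions G = {z \<in> center G. group.ord G z = 2}"

text \<open>If \<open>Z(G)\<close> and \<open>Z(H)\<close> have unique subgroups \<open>{1, z}\<close> and \<open>{1, w}\<close> of order 2, then the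
  subgroup factored out is \<open>{(1, 1), (z, w)}\<close>, so \<open>z\<close> is identified with \<open>w\<inverse> = w\<close>. If one
  of the factors is trivial, then it is the trivial subgroup and the central product is the
  other factor up to isomorphism. Both facts are proved below; in other cases the definition
  has no intended meaning.\<close>

definition amalgam :: "('a, 'c) monoid_scheme \<Rightarrow> ('b, 'd) monoid_scheme \<Rightarrow> ('a \<times> 'b) set" where
  "amalgam G H = generate (G \<times>\<times> H) (central_involutions G \<times> central_involutions H)"

definition central_product ::
  "('a, 'c) monoid_scheme \<Rightarrow> ('b, 'd) monoid_scheme \<Rightarrow> ('a \<times> 'b) set monoid" where
  "central_product G H = (G \<times>\<times> H) Mod (amalgam G H)"

text \<open>The type of a central product differs from the types of its factors. To iterate it, we
  replace a finite group by an isomorphic one whose elements are natural numbers. The condition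
  \<^term>\<open>group H\<close> is needed because \<^term>\<open>G \<cong> H\<close> does not constrain the unit field of the
  record \<open>H\<close>.\<close>

definition nat_copy :: "('a, 'b) monoid_scheme \<Rightarrow> nat monoid" where
  "nat_copy G = (SOME H. group H \<and> G \<cong> H)"

primrec central_power :: "('a, 'b) monoid_scheme \<Rightarrow> nat \<Rightarrow> nat monoid" where
  "central_power G 0 = singleton_group 0"
| "central_power G (Suc n) = nat_copy (central_product (central_power G n) G)"

lemma subgroup_center:
  fixes G (structure)
  assumes "group G"
  shows "subgroup (center G) G"
proof -
  interpret group G by fact
  show ?thesis
  proof (rule subgroupI)
    show "center G \<noteq> {}"
      by (auto simp: center_def intro!: exI[of _ "\<one>\<^bsub>G\<^esub>"])
  next
    fix a assume a: "a \<in> center G"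
    have "inv a \<otimes> x = x \<otimes> inv a" if x: "x \<in> carrier G" for x
    proof -
      have "a \<in> carrier G" "a \<otimes> x = x \<otimes> a"
        using a x by (auto simp: center_def)
      then show ?thesis
        using x by (metis inv_closed inv_solve_left inv_solve_right m_assoc m_closed)
    qed
    then show "inv a \<in> center G"
      using a by (auto simp: center_def)
  next
    fix a b assume ab: "a \<in> center G" "b \<in> center G"
    have c: "a \<in> carrier G" "b \<in> carrier G"
      using ab unfolding center_def by blast+
    have "a \<otimes> b \<otimes> x = x \<otimes> (a \<otimes> b)" if x: "x \<in> carrier G" for x
    proof -
      have "a \<otimes> b \<otimes> x = a \<otimes> (b \<otimes> x)" using c x by (simp add: m_assoc)
      also have "\<dots> = a \<otimes> (x \<otimes> b)" using ab x by (simp add: center_def)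
      also have "\<dots> = a \<otimes> x \<otimes> b" using c x by (simp add: m_assoc)
      also have "\<dots> = x \<otimes> a \<otimes> b" using ab x by (simp add: center_def)
      finally show ?thesis using c x by (simp add: m_assoc)
    qed
    moreover have "a \<otimes> b \<in> carrier G"
      using c by simp
    ultimately show "a \<otimes> b \<in> center G"
      unfolding center_def by blast
  qed (auto simp: center_def)
qed

lemma normal_generate_central:
  fixes G (structure)
  assumes "group G" "S \<subseteq> center G"
  shows "generate G S \<lhd> G"
proof -
  interpret group G by fact
  have sub: "generate G S \<subseteq> center G"
    using generate_subgroup_incl[OF assms(2) subgroup_center[OF assms(1)]] .
  have "S \<subseteq> carrier G"
    using assms(2) by (auto simp: center_def)
  then have "subgroup (generate G S) G"
    by (rule generate_is_subgroup)
  then show ?thesis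
  proof (rule normal_invI)
    fix x h assume x: "x \<in> carrier G" and h: "h \<in> generate G S"
    with sub have "h \<in> carrier G" "x \<otimes> h = h \<otimes> x"
      by (auto simp: center_def)
    with x have "x \<otimes> h \<otimes> inv x = h"
      by (simp add: m_assoc)
    with h show "x \<otimes> h \<otimes> inv x \<in> generate G S" by simp
  qed
qed

lemma center_DirProd:
  "center G \<times> center H \<subseteq> center (G \<times>\<times> H)"
  by (auto simp: center_def DirProd_def)

lemma normal_amalgam:
  assumes "group G" "group H"
  shows "amalgam G H \<lhd> G \<times>\<times> H"
  unfolding amalgam_def
proof (rule normal_generate_central)
  show "group (G \<times>\<times> H)"
    using assms by (rule DirProd_group)
  show "central_involutions G \<times> central_involutions H \<subseteq> center (G \<times>\<times> H)"
    using center_DirProd[of G H] by (auto simp: central_involutions_def)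
qed

lemma group_central_product:
  assumes "group G" "group H"
  shows "group (central_product G H)"
  unfolding central_product_def
  using normal_amalgam[OF assms] by (rule normal.factorgroup_is_group)

lemma finite_central_product:
  assumes "finite (carrier G)" "finite (carrier H)"
  shows "finite (carrier (central_product G H))"
  using assms by (simp add: central_product_def carrier_FactGroup)

lemma amalgam_eq:
  assumes "group G" "group H"
    and "central_involutions G = {z}" "central_involutions H = {w}"
  shows "amalgam G H = {\<one>\<^bsub>G \<times>\<times> H\<^esub>, (z, w)}"
proof -
  interpret G: group G by fact
  interpret H: group H by fact
  interpret GH: group "G \<times>\<times> H" using assms(1,2) by (rule DirProd_group)
  have z: "z \<in> carrier G" "G.ord z = 2" and w: "w \<in> carrier H" "H.ord w = 2"
    using assms(3,4) by (auto simp: central_involutions_def center_def)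
  have "z [^]\<^bsub>G\<^esub> (2::nat) = \<one>\<^bsub>G\<^esub>" "w [^]\<^bsub>H\<^esub> (2::nat) = \<one>\<^bsub>H\<^esub>"
    using z w by (metis G.pow_ord_eq_1, metis H.pow_ord_eq_1)
  then have sq: "z \<otimes>\<^bsub>G\<^esub> z = \<one>\<^bsub>G\<^esub>" "w \<otimes>\<^bsub>H\<^esub> w = \<one>\<^bsub>H\<^esub>"
    using z w by (simp_all add: numeral_2_eq_2)
  have "subgroup {\<one>\<^bsub>G \<times>\<times> H\<^esub>, (z, w)} (G \<times>\<times> H)"
  proof (rule GH.subgroupI)
    fix a assume a: "a \<in> {\<one>\<^bsub>G \<times>\<times> H\<^esub>, (z, w)}"
    have "inv\<^bsub>G \<times>\<times> H\<^esub> (z, w) = (z, w)"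
      using z w sq by (intro GH.inv_equality) auto
    with a show "inv\<^bsub>G \<times>\<times> H\<^esub> a \<in> {\<one>\<^bsub>G \<times>\<times> H\<^esub>, (z, w)}" by (auto simp del: one_DirProd)
  qed (use z w sq in auto)
  then have "generate (G \<times>\<times> H) {(z, w)} \<subseteq> {\<one>\<^bsub>G \<times>\<times> H\<^esub>, (z, w)}"
    by (intro GH.generate_subgroup_incl) auto
  moreover have "{\<one>\<^bsub>G \<times>\<times> H\<^esub>, (z, w)} \<subseteq> generate (G \<times>\<times> H) {(z, w)}"
    by (auto intro: generate.one generate.incl simp del: one_DirProd)
  ultimately show ?thesis
    using assms(3,4) by (simp add: amalgam_def del: one_DirProd)
qed

lemma central_product_trivial:
  assumes "group G" "group H" "carrier G = {\<one>\<^bsub>G\<^esub>}"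
  shows "H \<cong> central_product G H"
proof -
  interpret G: group G by fact
  interpret H: group H by fact
  interpret GH: group "G \<times>\<times> H" using assms(1,2) by (rule DirProd_group)
  have "central_involutions G = {}"
    using assms(3) by (auto simp: central_involutions_def center_def)
  then have N: "amalgam G H = {\<one>\<^bsub>G \<times>\<times> H\<^esub>}"
    by (simp add: amalgam_def GH.generate_empty)
  interpret N: normal "{\<one>\<^bsub>G \<times>\<times> H\<^esub>}" "G \<times>\<times> H"
    using normal_amalgam[OF assms(1,2)] N by simp
  have coset: "{\<one>\<^bsub>G \<times>\<times> H\<^esub>} #>\<^bsub>G \<times>\<times> H\<^esub> x = {x}" if "x \<in> carrier (G \<times>\<times> H)" for x
    using that by (auto simp: r_coset_def)
  have "(\<lambda>h. {(\<one>\<^bsub>G\<^esub>, h)}) \<in> iso H (central_product G H)"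
  proof (rule isoI)
    show "(\<lambda>h. {(\<one>\<^bsub>G\<^esub>, h)}) \<in> hom H (central_product G H)"
    proof (rule homI)
      fix x assume "x \<in> carrier H"
      then have "(\<one>\<^bsub>G\<^esub>, x) \<in> carrier (G \<times>\<times> H)" by simp
      from coset[OF this] this show "{(\<one>\<^bsub>G\<^esub>, x)} \<in> carrier (central_product G H)"
        unfolding central_product_def N carrier_FactGroup by (metis imageI)
    qed (simp add: central_product_def set_mult_def)
    show "bij_betw (\<lambda>h. {(\<one>\<^bsub>G\<^esub>, h)}) (carrier H) (carrier (central_product G H))"
      using assms(3) coset
      by (auto simp: bij_betw_def inj_on_def central_product_def N carrier_FactGroup
               image_iff simp del: one_DirProd)
  qed
  then show ?thesis by (rule is_isoI)
qed

lemma nat_copy: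
  fixes G :: "('a, 'b) monoid_scheme" (structure)
  assumes "group G" "finite (carrier G)"
  shows "group (nat_copy G)" "G \<cong> nat_copy G"
proof -
  interpret group G by fact
  obtain f :: "'a \<Rightarrow> nat" where "inj_on f (carrier G)"
    using finite_imp_inj_to_nat_seg[OF assms(2)] by auto
  define g where "g = inv_into (carrier G) f"
  have g: "g (f x) = x" if "x \<in> carrier G" for x
    using that \<open>inj_on f (carrier G)\<close> by (simp add: g_def)
  define H where "H = \<lparr>carrier = f ` carrier G, monoid.mult = (\<lambda>a b. f (g a \<otimes> g b)), one = f \<one>\<rparr>"
  have "group H"
  proof (rule groupI)
    fix x assume "x \<in> carrier H"
    then obtain a where "a \<in> carrier G" "x = f a" by (auto simp: H_def)
    then show "\<exists>y \<in> carrier H. y \<otimes>\<^bsub>H\<^esub> x = \<one>\<^bsub>H\<^esub>"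
      by (intro bexI[of _ "f (inv a)"]) (auto simp: H_def g)
  qed (auto simp: H_def g m_assoc)
  moreover have "f \<in> iso G H"
    using \<open>inj_on f (carrier G)\<close>
    by (auto simp: iso_def hom_def bij_betw_def H_def g)
  ultimately have "group H \<and> G \<cong> H" by (auto simp: is_isoI)
  then have "group (nat_copy G) \<and> G \<cong> nat_copy G"
    unfolding nat_copy_def by (rule someI)
  then show "group (nat_copy G)" "G \<cong> nat_copy G" by auto
qed

lemma central_power:
  assumes "group G" "finite (carrier G)"
  shows "group (central_power G n)" "finite (carrier (central_power G n))"
    and "central_power G (Suc n) \<cong> central_product (central_power G n) G"
proof -
  have *: "group (central_power G n) \<and> finite (carrier (central_power G n))" for n
  proof (induction n)
    case 0
    show ?case by simp
  next
    case (Suc n)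
    let ?P = "central_product (central_power G n) G"
    have P: "group ?P" "finite (carrier ?P)"
      using Suc assms by (auto intro: group_central_product finite_central_product)
    then obtain h where "bij_betw h (carrier ?P) (carrier (nat_copy ?P))"
      using nat_copy(2) by (auto simp: is_iso_def iso_def)
    then show ?case
      using nat_copy(1)[OF P] P(2) by (auto dest: bij_betw_finite)
  qed
  show "group (central_power G n)" "finite (carrier (central_power G n))"
    using * by auto
  let ?P = "central_product (central_power G n) G"
  have P: "group ?P" "finite (carrier ?P)"
    using *[of n] assms by (auto intro: group_central_product finite_central_product)
  show "central_power G (Suc n) \<cong> ?P"
    using group.iso_sym[OF P(1) nat_copy(2)[OF P]] by simp
qed

lemma central_power_1:
  assumes "group G" "finite (carrier G)"
  shows "G \<cong> central_power G 1"
proof -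
  have "G \<cong> central_product (central_power G 0) G"
    using central_product_trivial[of "central_power G 0" G] central_power(1)[OF assms, of 0] assms
    by (simp add: singleton_group_def)
  also have "\<dots> \<cong> central_power G 1"
    using assms by (simp add: nat_copy(2) group_central_product finite_central_product)
  finally show ?thesis .
qed

end

theory Submission
  imports Defs
begin

text \<open>All groups involved have exponent dividing 4, so the order statistics are determined by the
  group order, written \<open>2m\<close>, and the number of solutions of \<open>x\<^sup>2 = 1\<close>, written \<open>m + d\<close>. If all
  squares lie in \<open>{1, z}\<close>, then \<open>x\<^sup>2 = z\<close> has \<open>m - d\<close> solutions. In a central product, the class of
  \<open>(g, h)\<close> squares to 1 iff \<open>g\<^sup>2\<close> and \<open>h\<^sup>2\<close> are both trivial or both nontrivial, and every class has
  two elements, so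
  \<open>((m + d)(m' + d') + (m - d)(m' - d')) / 2 = m m' + d d'\<close>
  classes square to 1: both parameters are multiplicative. They are \<open>(4, 2)\<close> for \<open>D\<^sub>8\<close>, \<open>(4, -2)\<close> for
  \<open>Q\<^sub>8\<close> and \<open>(2, 0)\<close> for \<open>C\<^sub>4\<close>, and a direct factor \<open>C\<^sub>2\<^sup>k\<close> multiplies both by \<open>2\<^sup>k\<close>. To iterate
  central products of copies of \<open>D\<^sub>8\<close>, one also checks that the center stays of order 2.\<close>

section \<open>Element orders from the number of solutions of x^2 = 1\<close>

text \<open>The parameters are integers because \<open>d\<close> is negative for \<open>Q8\<close>.
  The exponent condition uses products only, so that it passes through homomorphisms by
  \<open>hom_mult\<close>.\<close>

definition square_count :: "('a, 'b) monoid_scheme \<Rightarrow> int \<Rightarrow> int \<Rightarrow> bool" where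
  "square_count G m d \<longleftrightarrow> group G \<and> finite (carrier G) \<and>
     (\<forall>x \<in> carrier G. (x \<otimes>\<^bsub>G\<^esub> x) \<otimes>\<^bsub>G\<^esub> (x \<otimes>\<^bsub>G\<^esub> x) = \<one>\<^bsub>G\<^esub>) \<and>
     int (card (carrier G)) = 2 * m \<and>
     int (card {x \<in> carrier G. x \<otimes>\<^bsub>G\<^esub> x = \<one>\<^bsub>G\<^esub>}) = m + d"

text \<open>If some square is nontrivial, it is \<open>z\<close>; if all squares are trivial,
  \<open>z\<close> may be any nontrivial element. In both cases \<open>z\<close> has order 2.
  Centrality of \<open>z\<close> is supplied separately, through the center or
  \<open>central_involutions\<close>.\<close>

definition square_type :: "('a, 'b) monoid_scheme \<Rightarrow> 'a \<Rightarrow> int \<Rightarrow> int \<Rightarrow> bool" where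
  "square_type G z m d \<longleftrightarrow> square_count G m d \<and> z \<in> carrier G \<and> z \<noteq> \<one>\<^bsub>G\<^esub> \<and>
     (\<forall>x \<in> carrier G. x \<otimes>\<^bsub>G\<^esub> x \<in> {\<one>\<^bsub>G\<^esub>, z})"

lemma (in group) ord_eq_2_iff:
  assumes "x \<in> carrier G"
  shows "ord x = 2 \<longleftrightarrow> x \<noteq> \<one> \<and> x \<otimes> x = \<one>"
proof
  assume "ord x = 2"
  then show "x \<noteq> \<one> \<and> x \<otimes> x = \<one>"
    using assms pow_ord_eq_1[of x] by (auto simp: numeral_2_eq_2)
next
  assume x: "x \<noteq> \<one> \<and> x \<otimes> x = \<one>"
  then have "x [^] (2::nat) = \<one>"
    using assms by (simp add: numeral_2_eq_2)
  then have "ord x dvd 2"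
    using assms pow_eq_id by blast
  moreover have "ord x \<noteq> 1"
    using x assms ord_eq_1 by blast
  ultimately show "ord x = 2"
    by (meson prime_nat_iff two_is_prime_nat)
qed

text \<open>Since x^4 = 1, every order is 1, 2 or 4. The \<open>m + d\<close> solutions of x^2 = 1
  are \<open>\<one>\<close> and the involutions; the remaining \<open>m - d\<close> elements have
  order 4. The sum of orders is 1 + 2(m + d - 1) + 4(m - d).\<close>

lemma order_counts:
  fixes G :: "('a, 'b) monoid_scheme" (structure)
  assumes "square_count G m d"
  shows "int (num_of_order 2 G) = m + d - 1"
    and "int (num_of_order 4 G) = m - d"
    and "int (sum_of_orders G) = 6 * m - 2 * d - 1"
proof -
  interpret group G using assms by (simp add: square_count_def)
  let ?A = "{x \<in> carrier G. x \<otimes> x = \<one>}"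
  let ?T = "{x \<in> carrier G. ord x = 2}" and ?F = "{x \<in> carrier G. ord x = 4}"
  have fin: "finite (carrier G)" and N: "int (card (carrier G)) = 2 * m"
    and A: "int (card ?A) = m + d"
    and four: "\<And>x. x \<in> carrier G \<Longrightarrow> (x \<otimes> x) \<otimes> (x \<otimes> x) = \<one>"
    using assms by (auto simp: square_count_def)
  have ord4: "ord x = 4" if x: "x \<in> carrier G" "x \<otimes> x \<noteq> \<one>" for x
  proof -
    have "x [^] (4::nat) = \<one>"
      using four x by (simp add: eval_nat_numeral m_assoc)
    then have "ord x dvd 2 ^ 2"
      using x pow_eq_id by auto
    then obtain i where "i \<le> 2" "ord x = 2 ^ i"
      using divides_primepow_nat[OF two_is_prime_nat] by blast
    moreover have "ord x \<noteq> 1" "ord x \<noteq> 2"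
      using x ord_eq_1 ord_eq_2_iff by auto
    ultimately show ?thesis
      by (cases "i = 0"; cases "i = 1"; cases "i = 2") auto
  qed
  have T: "?A = insert \<one> ?T" "\<one> \<notin> ?T"
    using ord_eq_2_iff by auto
  have F: "carrier G = ?A \<union> ?F" "?A \<inter> ?F = {}"
    using ord4 ord_eq_2_iff T(1) by (auto 4 3)
  have cT: "card ?A = Suc (card ?T)"
    unfolding T(1) using T(2) fin by (intro card_insert_disjoint) auto
  have cF: "card (carrier G) = card ?A + card ?F"
    using F fin by (metis (no_types, lifting) card_Un_disjoint finite_Un)
  show n2: "int (num_of_order 2 G) = m + d - 1" and n4: "int (num_of_order 4 G) = m - d"
    using A N cT cF by (auto simp: num_of_order_def)
  have "sum_of_orders G = (\<Sum>x\<in>?A. ord x) + (\<Sum>x\<in>?F. ord x)"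
    unfolding sum_of_orders_def using F fin
    by (metis (no_types, lifting) finite_Un sum.union_disjoint)
  also have "(\<Sum>x\<in>?A. ord x) = 1 + (\<Sum>x\<in>?T. ord x)"
    unfolding T(1) using fin by (subst sum.insert) (auto simp: ord_eq_1)
  finally have "sum_of_orders G = 1 + 2 * card ?T + 4 * card ?F"
    by simp
  then show "int (sum_of_orders G) = 6 * m - 2 * d - 1"
    using n2 n4 by (simp add: num_of_order_def)
qed

section \<open>Invariance under isomorphism, and the central involution\<close>

lemma square_count_iso:
  assumes "square_count G m d" "group H" "f \<in> iso G H"
  shows "square_count H m d"
proof -
  have G: "group G" using assms(1) by (simp add: square_count_def)
  interpret f: group_hom G H f
    using assms G by (simp add: group_hom_def group_hom_axioms_def iso_def)
  have bij: "bij_betw f (carrier G) (carrier H)"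
    using assms(3) by (simp add: iso_def)
  have im: "carrier H = f ` carrier G"
    using bij by (simp add: bij_betw_def)
  have inj: "inj_on f (carrier G)"
    using bij by (simp add: bij_betw_def)
  have "f (x \<otimes>\<^bsub>G\<^esub> x) = \<one>\<^bsub>H\<^esub> \<longleftrightarrow> x \<otimes>\<^bsub>G\<^esub> x = \<one>\<^bsub>G\<^esub>" if "x \<in> carrier G" for x
    using that inj f.hom_one f.G.one_closed f.G.m_closed by (metis inj_onD)
  then have "{y \<in> carrier H. y \<otimes>\<^bsub>H\<^esub> y = \<one>\<^bsub>H\<^esub>} = f ` {x \<in> carrier G. x \<otimes>\<^bsub>G\<^esub> x = \<one>\<^bsub>G\<^esub>}"
    by (auto simp: im simp flip: f.hom_mult)
  moreover have "inj_on f {x \<in> carrier G. x \<otimes>\<^bsub>G\<^esub> x = \<one>\<^bsub>G\<^esub>}"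
    using inj by (auto simp: inj_on_def)
  ultimately have "card {y \<in> carrier H. y \<otimes>\<^bsub>H\<^esub> y = \<one>\<^bsub>H\<^esub>} = card {x \<in> carrier G. x \<otimes>\<^bsub>G\<^esub> x = \<one>\<^bsub>G\<^esub>}"
    by (simp add: card_image)
  moreover have "(f x \<otimes>\<^bsub>H\<^esub> f x) \<otimes>\<^bsub>H\<^esub> (f x \<otimes>\<^bsub>H\<^esub> f x) = \<one>\<^bsub>H\<^esub>" if "x \<in> carrier G" for x
  proof -
    have "(f x \<otimes>\<^bsub>H\<^esub> f x) \<otimes>\<^bsub>H\<^esub> (f x \<otimes>\<^bsub>H\<^esub> f x) = f ((x \<otimes>\<^bsub>G\<^esub> x) \<otimes>\<^bsub>G\<^esub> (x \<otimes>\<^bsub>G\<^esub> x))"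
      using that by simp
    also have "\<dots> = \<one>\<^bsub>H\<^esub>"
      using that assms(1) by (simp add: square_count_def del: f.hom_mult)
    finally show ?thesis .
  qed
  ultimately show ?thesis
    using assms(1,2) bij_betw_same_card[OF bij] bij_betw_finite[OF bij]
    by (auto simp: square_count_def im)
qed

lemma square_type_iso:
  assumes "square_type G z m d" "group H" "f \<in> iso G H"
  shows "square_type H (f z) m d"
proof -
  have G: "group G" using assms(1) by (simp add: square_type_def square_count_def)
  interpret f: group_hom G H f
    using assms G by (simp add: group_hom_def group_hom_axioms_def iso_def)
  have im: "carrier H = f ` carrier G" and inj: "inj_on f (carrier G)"
    using assms(3) by (auto simp: iso_def bij_betw_def)
  have "square_count H m d"
    using assms(1) square_count_iso[OF _ assms(2,3)] by (simp add: square_type_def)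
  moreover have "f z \<noteq> \<one>\<^bsub>H\<^esub>"
    using assms(1) inj f.hom_one f.G.one_closed
    by (metis inj_onD square_type_def)
  moreover have "f x \<otimes>\<^bsub>H\<^esub> f x \<in> {\<one>\<^bsub>H\<^esub>, f z}" if "x \<in> carrier G" for x
  proof -
    have "x \<otimes>\<^bsub>G\<^esub> x \<in> {\<one>\<^bsub>G\<^esub>, z}"
      using that assms(1) by (simp add: square_type_def)
    then have "f (x \<otimes>\<^bsub>G\<^esub> x) \<in> {\<one>\<^bsub>H\<^esub>, f z}"
      by (auto simp del: f.hom_mult)
    then show ?thesis using that by simp
  qed
  ultimately show ?thesis
    using assms(1) by (auto simp: square_type_def im)
qed

lemma center_iso:
  assumes "f \<in> iso G H" "group G"
  shows "center H = f ` center G"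
proof -
  interpret G: group G by fact
  have im: "carrier H = f ` carrier G" and inj: "inj_on f (carrier G)"
    and mult: "\<And>x y. x \<in> carrier G \<Longrightarrow> y \<in> carrier G \<Longrightarrow> f (x \<otimes>\<^bsub>G\<^esub> y) = f x \<otimes>\<^bsub>H\<^esub> f y"
    using assms(1) by (auto simp: iso_def hom_def bij_betw_def)
  have "f z \<in> center H \<longleftrightarrow> z \<in> center G" if z: "z \<in> carrier G" for z
  proof -
    have "f z \<otimes>\<^bsub>H\<^esub> f x = f x \<otimes>\<^bsub>H\<^esub> f z \<longleftrightarrow> z \<otimes>\<^bsub>G\<^esub> x = x \<otimes>\<^bsub>G\<^esub> z" if x: "x \<in> carrier G" for x
      using z x inj_on_eq_iff[OF inj, of "z \<otimes>\<^bsub>G\<^esub> x" "x \<otimes>\<^bsub>G\<^esub> z"] by (simp add: mult)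
    then show ?thesis
      using z by (simp add: center_def im)
  qed
  moreover have "center H \<subseteq> f ` carrier G" "center G \<subseteq> carrier G"
    by (auto simp: center_def im)
  ultimately show ?thesis by blast
qed

text \<open>Turns knowledge of a center of order 2 into the singleton of involutions from which
  \<open>amalgam_eq\<close> computes the amalgamated subgroup.\<close>

lemma central_involutions_eq:
  fixes G (structure)
  assumes "group G" "center G = {\<one>, z}" "z \<noteq> \<one>"
  shows "central_involutions G = {z}"
proof -
  interpret group G by fact
  have "z \<in> center G"
    using assms(2) by simp
  then have z: "z \<in> carrier G" and "z \<otimes> z \<in> center G"
    using subgroup.m_closed[OF subgroup_center[OF assms(1)]] unfolding center_def by blast+
  then have "z \<otimes> z = \<one> \<or> z \<otimes> z = z"
    using assms(2) by simp
  then have "z \<otimes> z = \<one>"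
    using z assms(3) by auto
  with z show ?thesis
    using assms(2,3) by (auto simp: central_involutions_def ord_eq_2_iff)
qed

section \<open>Direct factors of exponent 2\<close>

lemma square_count_DirProd:
  assumes "square_count G m d" "group E" "finite (carrier E)"
    and "\<And>x. x \<in> carrier E \<Longrightarrow> x \<otimes>\<^bsub>E\<^esub> x = \<one>\<^bsub>E\<^esub>"
  shows "square_count (G \<times>\<times> E) (m * int (card (carrier E))) (d * int (card (carrier E)))"
proof -
  interpret E: group E by fact
  have "{x \<in> carrier (G \<times>\<times> E). x \<otimes>\<^bsub>G \<times>\<times> E\<^esub> x = \<one>\<^bsub>G \<times>\<times> E\<^esub>}
      = {x \<in> carrier G. x \<otimes>\<^bsub>G\<^esub> x = \<one>\<^bsub>G\<^esub>} \<times> carrier E"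
    using assms(4) by auto
  then show ?thesis
    using assms by (auto simp: square_count_def DirProd_group card_cartesian_product algebra_simps)
qed

lemma square_count_C2_power:
  assumes "square_count G m d"
  shows "square_count (G \<times>\<times> C2_power k) (m * 2 ^ k) (d * 2 ^ k)"
proof -
  have c: "carrier (integer_mod_group 2) = {0..<2}"
    by (simp add: carrier_integer_mod_group)
  have "card (carrier (C2_power k)) = 2 ^ k" "finite (carrier (C2_power k))"
    by (auto simp: c card_PiE intro!: finite_PiE)
  \<comment> \<open>No membership assumption is required: a doubled coordinate is 0 modulo 2, and
    outside the index set both sides are \<open>undefined\<close>.\<close>
  moreover have "x \<otimes>\<^bsub>C2_power k\<^esub> x = \<one>\<^bsub>C2_power k\<^esub>" for x
    by (auto simp: integer_mod_group_def fun_eq_iff restrict_def)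
  ultimately show ?thesis
    using square_count_DirProd[OF assms, of "C2_power k"] by simp
qed

section \<open>Central products with one identified involution\<close>

text \<open>Each fibre is a translate of the kernel. This moves counting in the central product back
  to the direct product.\<close>

lemma (in group_hom) card_vimage_surj:
  assumes "h ` carrier G = carrier H" "finite (carrier G)" "A \<subseteq> carrier H"
  shows "card {x \<in> carrier G. h x \<in> A} = card (kernel G H h) * card A"
proof -
  have "card {x \<in> carrier G. h x = a} = card (kernel G H h)" if "a \<in> A" for a
  proof -
    have "a \<in> h ` carrier G"
      using that assms(3) unfolding assms(1) by (rule rev_subsetD)
    then obtain y where y: "y \<in> carrier G" "h y = a"
      by blast
    have "{x \<in> carrier G. h x = a} = (\<lambda>x. x \<otimes> y) ` kernel G H h"
    proof (intro equalityI subsetI)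
      fix x assume "x \<in> {x \<in> carrier G. h x = a}"
      then have "x \<otimes> inv y \<in> kernel G H h" "x = (x \<otimes> inv y) \<otimes> y"
        using y by (auto simp: kernel_def G.m_assoc)
      then show "x \<in> (\<lambda>x. x \<otimes> y) ` kernel G H h" by blast
    qed (use y in \<open>auto simp: kernel_def\<close>)
    moreover have "inj_on (\<lambda>x. x \<otimes> y) (kernel G H h)"
      using y by (auto simp: inj_on_def kernel_def)
    ultimately show ?thesis by (simp add: card_image)
  qed
  moreover have "{x \<in> carrier G. h x \<in> A} = (\<Union>a\<in>A. {x \<in> carrier G. h x = a})"
    by auto
  moreover have "finite A"
    using assms by (metis finite_imageI finite_subset)
  ultimately show ?thesis
    using assms(2) by (subst \<open>_ = \<Union> _\<close>, subst card_UN_disjoint) auto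
qed

text \<open>Uniqueness of the two central involutions is what makes \<open>amalgam G H\<close> the
  two-element subgroup generated by \<open>(z, w)\<close>.\<close>

locale amalgamated = G: group G + H: group H
  for G (structure) and H (structure) +
  fixes z w
  assumes invol: "central_involutions G = {z}" "central_involutions H = {w}"
begin

sublocale GH: group "G \<times>\<times> H"
  by (rule DirProd_group) unfold_locales

abbreviation proj where "proj x \<equiv> amalgam G H #>\<^bsub>G \<times>\<times> H\<^esub> x"

sublocale Q: group "central_product G H"
  by (rule group_central_product) unfold_locales

lemma zw: "z \<in> carrier G" "z \<noteq> \<one>\<^bsub>G\<^esub>" "z \<otimes>\<^bsub>G\<^esub> z = \<one>\<^bsub>G\<^esub>" "z \<in> center G"
  "w \<in> carrier H" "w \<noteq> \<one>\<^bsub>H\<^esub>" "w \<otimes>\<^bsub>H\<^esub> w = \<one>\<^bsub>H\<^esub>" "w \<in> center H"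
proof -
  have "z \<in> center G" "w \<in> center H" "G.ord z = 2" "H.ord w = 2"
    using invol unfolding central_involutions_def by auto
  moreover from this have "z \<in> carrier G" "w \<in> carrier H"
    by (auto simp: center_def)
  ultimately show "z \<in> carrier G" "z \<noteq> \<one>\<^bsub>G\<^esub>" "z \<otimes>\<^bsub>G\<^esub> z = \<one>\<^bsub>G\<^esub>" "z \<in> center G"
    "w \<in> carrier H" "w \<noteq> \<one>\<^bsub>H\<^esub>" "w \<otimes>\<^bsub>H\<^esub> w = \<one>\<^bsub>H\<^esub>" "w \<in> center H"
    by (auto simp: G.ord_eq_2_iff H.ord_eq_2_iff)
qed

lemma amalgam: "amalgam G H = {(\<one>\<^bsub>G\<^esub>, \<one>\<^bsub>H\<^esub>), (z, w)}"
  using amalgam_eq[OF G.group_axioms H.group_axioms invol] by simp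

sublocale N: normal "amalgam G H" "G \<times>\<times> H"
  by (rule normal_amalgam) unfold_locales

sublocale proj: group_hom "G \<times>\<times> H" "central_product G H" proj
proof
  show "proj \<in> hom (G \<times>\<times> H) (central_product G H)"
    unfolding central_product_def by (rule N.r_coset_hom_Mod)
qed

lemma proj_surj: "proj ` carrier (G \<times>\<times> H) = carrier (central_product G H)"
  by (simp add: central_product_def carrier_FactGroup)

lemma proj_cases:
  assumes "q \<in> carrier (central_product G H)"
  obtains g h where "q = proj (g, h)" "g \<in> carrier G" "h \<in> carrier H"
proof -
  have "q \<in> proj ` carrier (G \<times>\<times> H)"
    using assms unfolding proj_surj .
  then obtain x where x: "q = proj x" "x \<in> carrier (G \<times>\<times> H)"
    by blast
  obtain g h where "x = (g, h)"
    by (cases x)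
  with x show ?thesis
    using that[of g h] by simp
qed

lemma kernel_proj: "kernel (G \<times>\<times> H) (central_product G H) proj = amalgam G H"
proof -
  have "proj x = amalgam G H \<longleftrightarrow> x \<in> amalgam G H" if "x \<in> carrier (G \<times>\<times> H)" for x
    using GH.rcos_self[OF that N.subgroup_axioms] N.rcos_const[OF GH.group_axioms, of x] by metis
  then show ?thesis
    using N.subset by (auto simp: kernel_def central_product_def)
qed

lemma card_kernel_proj: "card (kernel (G \<times>\<times> H) (central_product G H) proj) = 2"
  using zw(2) by (subst kernel_proj, subst amalgam) simp

lemma proj_eq_one_iff:
  assumes "x \<in> carrier (G \<times>\<times> H)"
  shows "proj x = \<one>\<^bsub>central_product G H\<^esub> \<longleftrightarrow> x = (\<one>\<^bsub>G\<^esub>, \<one>\<^bsub>H\<^esub>) \<or> x = (z, w)"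
  using kernel_proj assms unfolding kernel_def amalgam by blast

text \<open>The coset of y consists of y and its product with \<open>(z, w)\<close>.\<close>

lemma proj_eq_iff:
  assumes "x \<in> carrier (G \<times>\<times> H)" "y \<in> carrier (G \<times>\<times> H)"
  shows "proj x = proj y \<longleftrightarrow> x = y \<or> x = (z, w) \<otimes>\<^bsub>G \<times>\<times> H\<^esub> y"
proof -
  have "proj x = proj y \<longleftrightarrow> x \<otimes>\<^bsub>G \<times>\<times> H\<^esub> inv\<^bsub>G \<times>\<times> H\<^esub> y \<in> amalgam G H"
    using assms N.rcos_module[OF GH.group_axioms] GH.rcos_self GH.repr_independence N.subgroup_axioms
    by metis
  also have "\<dots> \<longleftrightarrow> x = y \<or> x = (z, w) \<otimes>\<^bsub>G \<times>\<times> H\<^esub> y"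
  proof -
    have "(z, w) \<in> carrier (G \<times>\<times> H)"
      using zw by simp
    then have "x \<otimes>\<^bsub>G \<times>\<times> H\<^esub> inv\<^bsub>G \<times>\<times> H\<^esub> y = (z, w) \<longleftrightarrow> x = (z, w) \<otimes>\<^bsub>G \<times>\<times> H\<^esub> y"
      using assms GH.inv_solve_right by (metis GH.inv_solve_right')
    moreover have "x \<otimes>\<^bsub>G \<times>\<times> H\<^esub> inv\<^bsub>G \<times>\<times> H\<^esub> y = \<one>\<^bsub>G \<times>\<times> H\<^esub> \<longleftrightarrow> x = y"
      using assms by (metis GH.inv_solve_right' GH.l_one GH.one_closed)
    ultimately show ?thesis
      by (subst amalgam) auto
  qed
  finally show ?thesis .
qed

lemma proj_central_swap: "proj (\<one>\<^bsub>G\<^esub>, w) = proj (z, \<one>\<^bsub>H\<^esub>)"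
  using zw by (subst proj_eq_iff) auto

lemma square_type_central_product:
  assumes "square_type G z m d" "square_type H w m' d'"
  shows "square_type (central_product G H) (proj (z, \<one>\<^bsub>H\<^esub>)) (m * m') (d * d')"
proof -
  let ?Q = "central_product G H"
  let ?A = "{g \<in> carrier G. g \<otimes>\<^bsub>G\<^esub> g = \<one>\<^bsub>G\<^esub>}" and ?B = "{h \<in> carrier H. h \<otimes>\<^bsub>H\<^esub> h = \<one>\<^bsub>H\<^esub>}"
  let ?R = "{q \<in> carrier ?Q. q \<otimes>\<^bsub>?Q\<^esub> q = \<one>\<^bsub>?Q\<^esub>}"
  have fin: "finite (carrier G)" "finite (carrier H)"
    and N: "int (card (carrier G)) = 2 * m" "int (card (carrier H)) = 2 * m'"
    and AB: "int (card ?A) = m + d" "int (card ?B) = m' + d'"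
    and sqG: "\<And>g. g \<in> carrier G \<Longrightarrow> g \<otimes>\<^bsub>G\<^esub> g = \<one>\<^bsub>G\<^esub> \<or> g \<otimes>\<^bsub>G\<^esub> g = z"
    and sqH: "\<And>h. h \<in> carrier H \<Longrightarrow> h \<otimes>\<^bsub>H\<^esub> h = \<one>\<^bsub>H\<^esub> \<or> h \<otimes>\<^bsub>H\<^esub> h = w"
    using assms by (auto simp: square_type_def square_count_def)
  have sq: "proj (g, h) \<otimes>\<^bsub>?Q\<^esub> proj (g, h) = proj (g \<otimes>\<^bsub>G\<^esub> g, h \<otimes>\<^bsub>H\<^esub> h)"
    if "g \<in> carrier G" "h \<in> carrier H" for g h
    using that proj.hom_mult[of "(g, h)" "(g, h)"] by simp
  have one: "proj (\<one>\<^bsub>G\<^esub>, \<one>\<^bsub>H\<^esub>) = \<one>\<^bsub>?Q\<^esub>" "proj (z, w) = \<one>\<^bsub>?Q\<^esub>"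
    "proj (z, \<one>\<^bsub>H\<^esub>) \<noteq> \<one>\<^bsub>?Q\<^esub>"
    using zw by (simp_all add: proj_eq_one_iff)
  have sqQ: "q \<otimes>\<^bsub>?Q\<^esub> q \<in> {\<one>\<^bsub>?Q\<^esub>, proj (z, \<one>\<^bsub>H\<^esub>)}" if q: "q \<in> carrier ?Q" for q
  proof -
    obtain g h where "q = proj (g, h)" "g \<in> carrier G" "h \<in> carrier H"
      using q by (rule proj_cases)
    then show ?thesis
      using sqG[of g] sqH[of h] sq[of g h] one proj_central_swap by auto
  qed
  have zQ: "proj (z, \<one>\<^bsub>H\<^esub>) \<in> carrier ?Q"
    using zw by (intro proj.hom_closed) simp
  \<comment> \<open>Gives the exponent condition: every square in the quotient is 1 or this
    element.\<close>
  have "proj (z, \<one>\<^bsub>H\<^esub>) \<otimes>\<^bsub>?Q\<^esub> proj (z, \<one>\<^bsub>H\<^esub>) = \<one>\<^bsub>?Q\<^esub>"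
    using zw sq[of z "\<one>\<^bsub>H\<^esub>"] one by simp
  then have four: "(q \<otimes>\<^bsub>?Q\<^esub> q) \<otimes>\<^bsub>?Q\<^esub> (q \<otimes>\<^bsub>?Q\<^esub> q) = \<one>\<^bsub>?Q\<^esub>" if "q \<in> carrier ?Q" for q
    using sqQ[OF that] by auto
  have finGH: "finite (carrier (G \<times>\<times> H))"
    using fin by simp
  \<comment> \<open>The kernel has order 2, so a subset of the quotient has half as many elements as
    its preimage.\<close>
  note card_vimage = proj.card_vimage_surj[OF proj_surj finGH, unfolded card_kernel_proj]
  have "{x \<in> carrier (G \<times>\<times> H). proj x \<in> carrier ?Q} = carrier G \<times> carrier H"
    using proj.hom_closed by auto
  then have order: "int (card (carrier ?Q)) = 2 * (m * m')"
    using arg_cong[OF card_vimage[OF subset_refl], of int] N by (simp add: card_cartesian_product)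
  \<comment> \<open>The pair of squares of g and h must be trivial or equal to
    \<open>(z, w)\<close>. As a nontrivial square is \<open>z\<close> or \<open>w\<close>, the
    second case says that g and h lie outside \<open>?A\<close> and \<open>?B\<close>.\<close>
  have "{x \<in> carrier (G \<times>\<times> H). proj x \<in> ?R} = ?A \<times> ?B \<union> (carrier G - ?A) \<times> (carrier H - ?B)"
    (is "?L = ?U")
  proof -
    have "(g, h) \<in> ?L \<longleftrightarrow> (g, h) \<in> ?U" for g h
    proof (cases "g \<in> carrier G \<and> h \<in> carrier H")
      case True
      then have "(g, h) \<in> ?L \<longleftrightarrow> g \<otimes>\<^bsub>G\<^esub> g = \<one>\<^bsub>G\<^esub> \<and> h \<otimes>\<^bsub>H\<^esub> h = \<one>\<^bsub>H\<^esub> \<or> g \<otimes>\<^bsub>G\<^esub> g = z \<and> h \<otimes>\<^bsub>H\<^esub> h = w"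
        using sq[of g h] proj_eq_one_iff[of "(g \<otimes>\<^bsub>G\<^esub> g, h \<otimes>\<^bsub>H\<^esub> h)"] proj.hom_closed[of "(g, h)"]
        by auto
      then show ?thesis
        using True sqG[of g] sqH[of h] zw(2,6) by auto
    qed auto
    then show ?thesis unfolding set_eq_iff split_paired_All by blast
  qed
  moreover have "card ?U = card ?A * card ?B + card (carrier G - ?A) * card (carrier H - ?B)"
    using fin by (subst card_Un_disjoint) (auto simp: card_cartesian_product)
  moreover have "card {x \<in> carrier (G \<times>\<times> H). proj x \<in> ?R} = 2 * card ?R"
    by (rule card_vimage) blast
  ultimately have "2 * card ?R = card ?A * card ?B + card (carrier G - ?A) * card (carrier H - ?B)"
    by argo
  from arg_cong[OF this, of int]
  have "2 * int (card ?R) = int (card ?A) * int (card ?B)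
      + int (card (carrier G - ?A)) * int (card (carrier H - ?B))"
    by (simp only: of_nat_mult of_nat_add of_nat_numeral)
  moreover have "int (card (carrier G - ?A)) = m - d" "int (card (carrier H - ?B)) = m' - d'"
    using N AB fin by (subst card_Diff_subset; force simp: of_nat_diff card_mono)+
  ultimately have "2 * int (card ?R) = (m + d) * (m' + d') + (m - d) * (m' - d')"
    using AB by argo
  then have "int (card ?R) = m * m' + d * d'"
    by (simp add: algebra_simps)
  then show ?thesis
    unfolding square_type_def square_count_def
    using order four sqQ zQ one(3) Q.group_axioms finite_central_product[OF fin] by blast
qed

text \<open>Allows iteration: the product again has a center of order 2, hence a unique central
  involution to identify at the next stage.\<close>

lemma center_central_product:
  assumes "center G = {\<one>\<^bsub>G\<^esub>, z}" "center H = {\<one>\<^bsub>H\<^esub>, w}"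
  shows "center (central_product G H) = {\<one>\<^bsub>central_product G H\<^esub>, proj (z, \<one>\<^bsub>H\<^esub>)}"
proof -
  let ?Q = "central_product G H"
  \<comment> \<open>Commuting in the quotient is commuting in the direct product up to a factor
    \<open>(z, w)\<close>.\<close>
  have comm: "g \<otimes>\<^bsub>G\<^esub> x = x \<otimes>\<^bsub>G\<^esub> g \<and> h \<otimes>\<^bsub>H\<^esub> y = y \<otimes>\<^bsub>H\<^esub> h
      \<or> g \<otimes>\<^bsub>G\<^esub> x = z \<otimes>\<^bsub>G\<^esub> (x \<otimes>\<^bsub>G\<^esub> g) \<and> h \<otimes>\<^bsub>H\<^esub> y = w \<otimes>\<^bsub>H\<^esub> (y \<otimes>\<^bsub>H\<^esub> h)"
    if "proj (g, h) \<in> center ?Q" "g \<in> carrier G" "h \<in> carrier H" "x \<in> carrier G" "y \<in> carrier H"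
    for g h x y
  proof -
    have "proj (g, h) \<otimes>\<^bsub>?Q\<^esub> proj (x, y) = proj (x, y) \<otimes>\<^bsub>?Q\<^esub> proj (g, h)"
      using that proj.hom_closed[of "(x, y)"] by (simp add: center_def)
    then have "proj (g \<otimes>\<^bsub>G\<^esub> x, h \<otimes>\<^bsub>H\<^esub> y) = proj (x \<otimes>\<^bsub>G\<^esub> g, y \<otimes>\<^bsub>H\<^esub> h)"
      using that proj.hom_mult[of "(g, h)" "(x, y)"] proj.hom_mult[of "(x, y)" "(g, h)"] by simp
    then show ?thesis
      using that by (subst (asm) proj_eq_iff) auto
  qed
  have "proj (g, h) \<in> center ?Q \<longleftrightarrow> g \<in> center G \<and> h \<in> center H"
    if gh: "g \<in> carrier G" "h \<in> carrier H" for g h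
  proof
    assume c: "proj (g, h) \<in> center ?Q"
    have "g \<otimes>\<^bsub>G\<^esub> x = x \<otimes>\<^bsub>G\<^esub> g" if "x \<in> carrier G" for x
      using comm[OF c gh that H.one_closed] gh zw by auto
    moreover have "h \<otimes>\<^bsub>H\<^esub> y = y \<otimes>\<^bsub>H\<^esub> h" if "y \<in> carrier H" for y
      using comm[OF c gh G.one_closed that] gh zw by auto
    ultimately show "g \<in> center G \<and> h \<in> center H"
      using gh by (auto simp: center_def)
  next
    assume c: "g \<in> center G \<and> h \<in> center H"
    have "proj (g, h) \<otimes>\<^bsub>?Q\<^esub> q = q \<otimes>\<^bsub>?Q\<^esub> proj (g, h)" if q: "q \<in> carrier ?Q" for q
    proof -
      obtain x y where "q = proj (x, y)" "x \<in> carrier G" "y \<in> carrier H"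
        using q by (rule proj_cases)
      then show ?thesis
        using c gh proj.hom_mult[of "(g, h)" "(x, y)"] proj.hom_mult[of "(x, y)" "(g, h)"]
        by (simp add: center_def)
    qed
    then show "proj (g, h) \<in> center ?Q"
      using gh proj.hom_closed[of "(g, h)"] by (simp add: center_def)
  qed
  note central_iff = this
  have "center ?Q = proj ` (center G \<times> center H)"
  proof (intro equalityI subsetI)
    fix q assume q: "q \<in> center ?Q"
    then have "q \<in> carrier ?Q" by (simp add: center_def)
    then obtain g h where "q = proj (g, h)" "g \<in> carrier G" "h \<in> carrier H"
      by (rule proj_cases)
    then show "q \<in> proj ` (center G \<times> center H)"
      using q central_iff by blast
  next
    fix q assume "q \<in> proj ` (center G \<times> center H)"
    then obtain g h where q: "q = proj (g, h)" "g \<in> center G" "h \<in> center H"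
      by blast
    moreover from this have "g \<in> carrier G" "h \<in> carrier H"
      by (simp_all add: center_def)
    ultimately show "q \<in> center ?Q"
      using central_iff by blast
  qed
  \<comment> \<open>The four central pairs collapse to two classes: (1, 1) with (z, w), and (z, 1)
    with (1, w).\<close>
  also have "\<dots> = {\<one>\<^bsub>?Q\<^esub>, proj (z, \<one>\<^bsub>H\<^esub>)}"
    using zw proj_central_swap proj_eq_one_iff[of "(\<one>\<^bsub>G\<^esub>, \<one>\<^bsub>H\<^esub>)"] proj_eq_one_iff[of "(z, w)"]
    by (auto simp: assms)
  finally show ?thesis .
qed

end

lemma square_count_central_product:
  assumes "square_type G z m d" "square_type H w m' d'"
    and "central_involutions G = {z}" "central_involutions H = {w}"
  shows "square_count (central_product G H) (m * m') (d * d')"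
proof -
  have "group G" "group H"
    using assms(1,2) by (simp_all add: square_type_def square_count_def)
  then interpret amalgamated G H z w
    using assms(3,4) by (intro amalgamated.intro amalgamated_axioms.intro)
  show ?thesis
    using square_type_central_product[OF assms(1,2)] by (simp add: square_type_def)
qed

section \<open>The building blocks \<open>D8\<close>, \<open>Q8\<close> and the cyclic group of
  order 4\<close>

lemma carrier_D8: "carrier D8 = {0, 1, 2, 3} \<times> {False, True}"
  by (auto simp: dihedral_def)

text \<open>The element \<open>(2, False)\<close> is the rotation by a half turn. With the identity
  and the four reflections it gives 6 = 4 + 2 solutions of x^2 = 1.\<close>

lemma square_type_D8: "square_type D8 (2, False) 4 2"
proof -
  have "{x \<in> carrier D8. x \<otimes>\<^bsub>D8\<^esub> x = \<one>\<^bsub>D8\<^esub>}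
      = {(0, False), (2, False), (0, True), (1, True), (2, True), (3, True)}"
    unfolding carrier_D8 by (auto simp: dihedral_def)
  then show ?thesis
    unfolding square_type_def square_count_def
    by (simp add: group_dihedral carrier_D8 card_cartesian_product) (simp add: dihedral_def)
qed

lemma center_D8: "center D8 = {\<one>\<^bsub>D8\<^esub>, (2, False)}"
  unfolding center_def carrier_D8 by (auto simp: dihedral_def)

lemma square_type_Q8: "square_type Q8 (-1, 0, 0, 0) 4 (- 2)"
proof -
  have "{x \<in> carrier Q8. x \<otimes>\<^bsub>Q8\<^esub> x = \<one>\<^bsub>Q8\<^esub>} = {(1, 0, 0, 0), (-1, 0, 0, 0)}"
    by (auto simp: Q8_def)
  then show ?thesis
    unfolding square_type_def square_count_def
    by (simp add: group_Q8) (simp add: Q8_def)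
qed

lemma center_Q8: "center Q8 = {\<one>\<^bsub>Q8\<^esub>, (-1, 0, 0, 0)}"
  unfolding center_def by (auto simp: Q8_def)

lemma carrier_C4: "carrier (integer_mod_group 4) = {0, 1, 2, 3}"
  by (auto simp: carrier_integer_mod_group)

lemma square_type_C4: "square_type (integer_mod_group 4) 2 2 0"
proof -
  have "{x \<in> carrier (integer_mod_group 4). x \<otimes>\<^bsub>integer_mod_group 4\<^esub> x = \<one>\<^bsub>integer_mod_group 4\<^esub>}
      = {0, 2}"
    unfolding carrier_C4 by auto
  then show ?thesis
    unfolding square_type_def square_count_def by (simp add: carrier_C4)
qed

text \<open>Here the center is the whole group, of order 4, so \<open>central_involutions_eq\<close>
  does not apply and the involution is found directly.\<close>

lemma central_involutions_C4: "central_involutions (integer_mod_group 4) = {2}"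
proof -
  interpret group "integer_mod_group 4" by simp
  have "center (integer_mod_group 4) = {0, 1, 2, 3}"
    by (auto simp: center_def carrier_C4 add.commute)
  then show ?thesis
    by (auto simp: central_involutions_def ord_eq_2_iff carrier_C4)
qed

section \<open>Iterated central products of \<open>D8\<close>\<close>

text \<open>\<open>nat_copy\<close> determines a group only up to isomorphism, so the involution
  stays existential. Both facts share one witness because the next central product needs them for
  the same element.\<close>

lemma square_type_center_iso:
  assumes "square_type G z m d" "center G = {\<one>\<^bsub>G\<^esub>, z}" "group H" "G \<cong> H"
  shows "\<exists>z'. square_type H z' m d \<and> center H = {\<one>\<^bsub>H\<^esub>, z'}"
proof -
  have G: "group G" using assms(1) by (simp add: square_type_def square_count_def)
  obtain f where f: "f \<in> iso G H" using assms(4) by (auto simp: is_iso_def)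
  then have "f \<one>\<^bsub>G\<^esub> = \<one>\<^bsub>H\<^esub>"
    using G assms(3) by (simp add: iso_def hom_one)
  then show ?thesis
    using square_type_iso[OF assms(1,3) f] center_iso[OF f G] assms(2) by auto
qed

text \<open>The center is part of the induction claim because the step needs the unique central
  involution. The induction starts at 1, since the trivial group \<open>central_power D8 0\<close>
  has none.\<close>

lemma square_type_central_power_D8:
  assumes "n \<ge> 1"
  shows "\<exists>z. square_type (central_power D8 n) z (4 ^ n) (2 ^ n) \<and>
           center (central_power D8 n) = {\<one>\<^bsub>central_power D8 n\<^esub>, z}"
proof -
  have D8: "group D8" "finite (carrier D8)"
    by (simp_all add: group_dihedral carrier_D8)
  show ?thesis
    using assms
  proof (induction n rule: nat_induct_at_least)
    case base
    show ?case
      using square_type_center_iso[OF square_type_D8 center_D8 central_power(1)[OF D8] central_power_1[OF D8]]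
      by simp
  next
    case (Suc n)
    let ?P = "central_power D8 n"
    obtain z where z: "square_type ?P z (4 ^ n) (2 ^ n)" "center ?P = {\<one>\<^bsub>?P\<^esub>, z}"
      using Suc by blast
    interpret P: group ?P by (rule central_power(1)[OF D8])
    interpret D: group D8 by (rule D8)
    interpret amalgamated ?P D8 z "(2, False)"
    proof
      show "central_involutions ?P = {z}"
        using z by (intro central_involutions_eq P.group_axioms) (auto simp: square_type_def)
      show "central_involutions D8 = {(2, False)}"
        using center_D8 square_type_D8
        by (intro central_involutions_eq D8) (auto simp: square_type_def)
    qed
    have "central_product ?P D8 \<cong> central_power D8 (Suc n)"
      using central_power(3)[OF D8] group.iso_sym[OF central_power(1)[OF D8]] by blast
    then show ?case
      using square_type_center_iso[OF square_type_central_product[OF z(1) square_type_D8]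
          center_central_product[OF z(2) center_D8] central_power(1)[OF D8], of "Suc n"]
      by (simp add: mult.commute del: central_power.simps)
  qed
qed

lemma square_count_D8_power:
  assumes "n \<ge> 1"
  shows "square_count (central_power D8 n) (4 ^ n) (2 ^ n)"
  using square_type_central_power_D8[OF assms] by (auto simp: square_type_def)

text \<open>Asks of \<open>H\<close> a unique central involution instead of a center of order 2, so
  that one statement serves both \<open>Q8\<close> and the cyclic group of order 4.\<close>

lemma square_count_D8_power_mult:
  assumes "n \<ge> 1" "square_type H w m d" "central_involutions H = {w}"
  shows "square_count (central_product (central_power D8 n) H) (4 ^ n * m) (2 ^ n * d)"
proof -
  obtain z where z: "square_type (central_power D8 n) z (4 ^ n) (2 ^ n)"
    "center (central_power D8 n) = {\<one>\<^bsub>central_power D8 n\<^esub>, z}"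
    using square_type_central_power_D8[OF assms(1)] by blast
  then have "central_involutions (central_power D8 n) = {z}"
    by (intro central_involutions_eq) (auto simp: square_type_def square_count_def)
  then show ?thesis
    using square_count_central_product[OF z(1) assms(2) _ assms(3)] by simp
qed

text \<open>For \<open>n = 1\<close> the left factor is trivial and has no central involution, so that case is
  separate.\<close>

lemma square_count_D8_power_Q8:
  assumes "n \<ge> 1"
  shows "square_count (central_product (central_power D8 (n - 1)) Q8) (4 ^ n) (- (2 ^ n))"
proof (cases "n = 1")
  case True
  have "group (central_power D8 0)"
    by simp
  then have "Q8 \<cong> central_product (central_power D8 0) Q8"
    by (rule central_product_trivial[OF _ group_Q8]) (simp add: singleton_group_def)
  then obtain f where "f \<in> iso Q8 (central_product (central_power D8 0) Q8)"
    by (auto simp: is_iso_def)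
  moreover have "square_count Q8 4 (- 2)"
    using square_type_Q8 by (simp add: square_type_def)
  moreover have "group (central_product (central_power D8 0) Q8)"
    by (intro group_central_product group_Q8) simp
  ultimately show ?thesis
    using True square_count_iso by fastforce
next
  case False
  have "central_involutions Q8 = {(-1, 0, 0, 0)}"
    using center_Q8 square_type_Q8
    by (intro central_involutions_eq group_Q8) (auto simp: square_type_def)
  then have "square_count (central_product (central_power D8 (n - 1)) Q8)
      (4 ^ (n - 1) * 4) (2 ^ (n - 1) * - 2)"
    using False assms by (intro square_count_D8_power_mult[OF _ square_type_Q8]) auto
  moreover obtain m where "n = Suc m"
    using assms by (cases n) auto
  ultimately show ?thesis by (simp add: mult.commute)
qed

lemma square_count_D8_power_C4:
  assumes "n \<ge> 1"
  shows "square_count (central_product (central_power D8 n) (integer_mod_group 4)) (4 ^ n * 2) 0"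
  using square_count_D8_power_mult[OF assms square_type_C4 central_involutions_C4] by simp

section \<open>The six families\<close>

lemma order_counts_iso:
  assumes "group G" "G \<cong> H" "square_count H m d"
  shows "int (num_of_order 2 G) = m + d - 1 \<and> int (num_of_order 4 G) = m - d \<and>
    int (sum_of_orders G) = 6 * m - 2 * d - 1"
proof -
  obtain f where "f \<in> iso H G"
    using group.iso_sym[OF assms(1,2)] by (auto simp: is_iso_def)
  then show ?thesis
    using order_counts square_count_iso[OF assms(3,1)] by blast
qed

theorem theorem2p5:
  fixes G :: "('a, 'b) monoid_scheme" and n k :: nat
  assumes "extraspecial 2 G \<or> almost_extraspecial 2 G \<or> generalized_extraspecial 2 G"
    and "n \<ge> 1"
  shows
    "(G \<cong> central_power D8 n \<longrightarrow>
        int (num_of_order 2 G) = 4 ^ n + 2 ^ n - 1 \<and>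
        int (num_of_order 4 G) = 4 ^ n - 2 ^ n \<and>
        int (sum_of_orders G) = 6 * 2 ^ (2 * n) - 2 * 2 ^ n - 1) \<and>
     (G \<cong> central_product (central_power D8 (n - 1)) Q8 \<longrightarrow>
        int (num_of_order 2 G) = 4 ^ n - 2 ^ n - 1 \<and>
        int (num_of_order 4 G) = 4 ^ n + 2 ^ n \<and>
        int (sum_of_orders G) = 6 * 2 ^ (2 * n) + 2 * 2 ^ n - 1) \<and>
     (G \<cong> central_product (central_power D8 n) (integer_mod_group 4) \<longrightarrow>
        int (num_of_order 2 G) = 2 ^ (2 * n + 1) - 1 \<and>
        int (num_of_order 4 G) = 2 ^ (2 * n + 1) \<and>
        int (sum_of_orders G) = 12 * 2 ^ (2 * n) - 1) \<and>
     (G \<cong> central_power D8 n \<times>\<times> C2_power k \<longrightarrow>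
        int (num_of_order 2 G) = 2 ^ (2 * n + k) + 2 ^ (n + k) - 1 \<and>
        int (num_of_order 4 G) = 2 ^ (2 * n + k) - 2 ^ (n + k) \<and>
        int (sum_of_orders G) = 6 * 2 ^ (2 * n + k) - 2 * 2 ^ (n + k) - 1) \<and>
     (G \<cong> central_product (central_power D8 (n - 1)) Q8 \<times>\<times> C2_power k \<longrightarrow>
        int (num_of_order 2 G) = 2 ^ (2 * n + k) - 2 ^ (n + k) - 1 \<and>
        int (num_of_order 4 G) = 2 ^ (2 * n + k) + 2 ^ (n + k) \<and>
        int (sum_of_orders G) = 6 * 2 ^ (2 * n + k) + 2 * 2 ^ (n + k) - 1) \<and>
     (G \<cong> central_product (central_power D8 n) (integer_mod_group 4) \<times>\<times> C2_power k \<longrightarrow>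
        int (num_of_order 2 G) = 2 ^ (2 * n + k + 1) - 1 \<and>
        int (num_of_order 4 G) = 2 ^ (2 * n + k + 1) \<and>
        int (sum_of_orders G) = 12 * 2 ^ (2 * n + k) - 1)"
proof -
  \<comment> \<open>Provides the group axioms for \<open>G\<close>; being isomorphic to a group
    would leave the unit field of \<open>G\<close> unconstrained.\<close>
  have "finite_p_group 2 G"
    using assms(1) by (auto simp: extraspecial_def special_def almost_extraspecial_def
        generalized_extraspecial_def)
  then interpret group G by (simp add: finite_p_group_def)
  \<comment> \<open>The claims mix powers of 4 and of 2; base 2 makes their exponents
    comparable.\<close>
  have p: "(4::int) ^ n = 2 ^ (2 * n)" by (simp add: power_mult)
  note D8 = square_count_D8_power[OF assms(2)]
    and Q8 = square_count_D8_power_Q8[OF assms(2)]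
    and C4 = square_count_D8_power_C4[OF assms(2)]
  note times = square_count_C2_power[where k = k]
  note counts = order_counts_iso[OF group_axioms]
  show ?thesis
    \<comment> \<open>The pairs (m, d) are (4^n, 2^n), (4^n, -2^n) and (2 4^n, 0), followed by the
      same three scaled by 2^k.\<close>
    using counts[OF _ D8] counts[OF _ Q8] counts[OF _ C4]
      counts[OF _ times[OF D8]] counts[OF _ times[OF Q8]] counts[OF _ times[OF C4]]
    by (intro conjI impI) (simp_all add: p power_add algebra_simps)
qed

end
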